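(* There exist three absolute positive constants $C_1', c_0', C_0'$ such that the following holds. Let $\Omega\subset\mathbb{R}^d$ be a nonempty set with a probability measure $\mu$, and let $X_N$ be an $N$-dimensional subspace of the complex space $L_2(\Omega,\mu)$. Then there exist $m\le C_1'N$ points $\xi^1,\dots,\xi^m\in\Omega$ and nonnegative weights $\lambda_1,\dots,\lambda_m$ such that $$c_0'\|f\|_2^2\le\sum_{j=1}^m\lambda_j|f(\xi^j)|^2\le C_0'\|f\|_2^2\qquad\text{for all } f\in X_N .$$
   Context: $\|f\|_2:=\left(\int_\Omega|f|^2\,d\mu\right)^{1/2}$. Elements of $L_2(\Omega,\mu)$ are understood as specific functions, not equivalence classes; $X_N$ is $N$-dimensional if $X_N=\operatorname{span}(u_1,\dots,u_N)$ for some $N$ linearly independent functions $u_1,\dots,u_N\in X_N$, and each $f\in X_N$ is assumed to be defined at every point of $\Omega$. "Absolute" means that the constants do not depend on $d,\Omega,\mu,N$ or $X_N$. *)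

theory Defs
  imports "HOL-Probability.Probability" "HOL-Library.Function_Algebras"
begin

text \<open>The dimension \<open>d\<close> has to be quantified inside the scope of the absolute constants, so
  \<open>\<real>\<^sup>d\<close> is a set of tuples indexed by \<open>{1..d}\<close> rather than a type.\<close>

definition Rd :: "nat \<Rightarrow> (nat \<Rightarrow> real) set" where
  "Rd d = ({1..d} \<rightarrow>\<^sub>E UNIV)"

definition fun_scale :: "complex \<Rightarrow> ('a \<Rightarrow> complex) \<Rightarrow> 'a \<Rightarrow> complex" where
  "fun_scale c f = (\<lambda>x. c * f x)"

interpretation cfun: vector_space fun_scale
  by unfold_locales (auto simp: fun_scale_def fun_eq_iff algebra_simps)

text \<open>Elements of \<open>L\<^sub>2(\<Omega>, \<mu>)\<close> are functions, not equivalence classes: functions that agree almost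
  everywhere are not identified. A function on \<open>\<Omega> = space M\<close> is represented by its extension by
  zero, so that the linear operations and linear independence of total functions are exactly the
  pointwise ones on \<open>\<Omega>\<close>.\<close>

definition L2_fun :: "'a measure \<Rightarrow> ('a \<Rightarrow> complex) set" where
  "L2_fun M = {f \<in> borel_measurable M.
     integrable M (\<lambda>x. (cmod (f x))\<^sup>2) \<and> (\<forall>x. x \<notin> space M \<longrightarrow> f x = 0)}"

definition L2_norm :: "'a measure \<Rightarrow> ('a \<Rightarrow> complex) \<Rightarrow> real" where
  "L2_norm M f = sqrt (\<integral>x. (cmod (f x))\<^sup>2 \<partial>M)"

text \<open>The library's \<open>cfun.dim\<close> is also 0 for infinite-dimensional spaces, hence the explicit basis.\<close>

definition L2_subspace_dim :: "'a measure \<Rightarrow> nat \<Rightarrow> ('a \<Rightarrow> complex) set \<Rightarrow> bool" where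
  "L2_subspace_dim M N X \<longleftrightarrow> X \<subseteq> L2_fun M \<and>
     (\<exists>U. finite U \<and> card U = N \<and> cfun.independent U \<and> X = cfun.span U)"

end

theory Submission
  imports Defs
begin

text \<open>Modulo null functions, an orthonormal basis \<open>e\<close> of \<open>X\<^sub>N\<close> turns \<open>f = \<Sum>\<^sub>i c\<^sub>i e\<^sub>i\<close> into
  \<open>f(x) = \<langle>c, v(x)\<rangle>\<close> with \<open>v(x)\<^sub>i = cnj (e\<^sub>i(x))\<close>, and \<open>v\<close> is isotropic: \<open>\<integral> v v\<^sup>* d\<mu> = I\<close>.
  The points are chosen greedily by a barrier argument in the style of Batson, Spielman and Srivastava,
  run directly against \<open>\<mu>\<close>. Keeping the potential \<open>tr (u - A)\<^sup>-\<^sup>1 + tr (A - l)\<^sup>-\<^sup>1\<close> at most \<open>2n\<close>, one adds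
  \<open>t v(x) v(x)\<^sup>*\<close> to \<open>A\<close> while \<open>l\<close> and \<open>u\<close> advance by \<open>1/(12n)\<close> and \<open>1/(4n)\<close>; averaging over \<open>\<mu>\<close> shows
  that a suitable \<open>x\<close> exists. Starting from \<open>A = 0\<close>, \<open>l = -1\<close>, \<open>u = 1\<close>, after \<open>24n\<close> steps
  \<open>I \<le> A \<le> 7 I\<close>.

  Operators are self-adjoint maps on the vectors supported in \<open>{..<n}\<close>; self-adjointness already
  implies linearity.\<close>

section \<open>Vectors and inner products in \<open>\<complex>^n\<close>\<close>

text \<open>The dimension is only obtained inside a proof, from orthonormalisation, so it cannot be
  a type parameter. Extension by zero makes equality of functions the same as equality of
  vectors.\<close>

definition vecs :: "nat \<Rightarrow> (nat \<Rightarrow> complex) set" where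
  "vecs n = {x. \<forall>i\<ge>n. x i = 0}"

definition ip :: "nat \<Rightarrow> (nat \<Rightarrow> complex) \<Rightarrow> (nat \<Rightarrow> complex) \<Rightarrow> complex" where
  "ip n x y = (\<Sum>i<n. x i * cnj (y i))"

definition nsq :: "nat \<Rightarrow> (nat \<Rightarrow> complex) \<Rightarrow> real" where
  "nsq n x = (\<Sum>i<n. (cmod (x i))\<^sup>2)"

definition unitv :: "nat \<Rightarrow> nat \<Rightarrow> complex" where
  "unitv i = (\<lambda>j. if j = i then 1 else 0)"

lemma ip_add_left: "ip n (\<lambda>i. x i + y i) z = ip n x z + ip n y z"
  by (simp add: ip_def sum.distrib algebra_simps)

lemma ip_diff_left: "ip n (\<lambda>i. x i - y i) z = ip n x z - ip n y z"
  by (simp add: ip_def sum_subtractf algebra_simps)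

lemma ip_scale_left: "ip n (\<lambda>i. c * x i) z = c * ip n x z"
  by (simp add: ip_def sum_distrib_left algebra_simps)

lemma cnj_ip: "cnj (ip n x y) = ip n y x"
  by (simp add: ip_def mult.commute)

lemma ip_add_right: "ip n z (\<lambda>i. x i + y i) = ip n z x + ip n z y"
  by (simp add: ip_def sum.distrib algebra_simps)

lemma ip_diff_right: "ip n z (\<lambda>i. x i - y i) = ip n z x - ip n z y"
  by (simp add: ip_def sum_subtractf algebra_simps)

lemma ip_scale_right: "ip n z (\<lambda>i. c * x i) = cnj c * ip n z x"
  by (simp add: ip_def sum_distrib_left algebra_simps)

lemmas ip_linear = ip_add_left ip_diff_left ip_scale_left ip_add_right ip_diff_right ip_scale_right

lemma ip_zero [simp]: "ip n (\<lambda>_. 0) x = 0" "ip n x (\<lambda>_. 0) = 0"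
  by (simp_all add: ip_def)

lemma ip_self: "ip n x x = of_real (nsq n x)"
  by (simp add: ip_def nsq_def complex_norm_square flip: of_real_power)

lemma Re_ip_commute: "Re (ip n x y) = Re (ip n y x)"
  by (metis cnj_ip cnj.simps(1))

lemma norm_ip_commute: "cmod (ip n x y) = cmod (ip n y x)"
  by (metis cnj_ip complex_mod_cnj)

lemma ip_mult_cnj: "ip n x y * ip n y x = of_real ((cmod (ip n x y))\<^sup>2)"
  by (metis cnj_ip complex_norm_square)

lemma nsq_nonneg: "0 \<le> nsq n x"
  by (simp add: nsq_def sum_nonneg)

lemma nsq_pos:
  assumes "x \<in> vecs n" "x \<noteq> (\<lambda>_. 0)"
  shows "0 < nsq n x"
proof -
  obtain i where i: "x i \<noteq> 0" using assms(2) by auto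
  with assms(1) have "i < n" unfolding vecs_def by (simp add: linorder_not_le[symmetric]) blast
  with i show ?thesis
    unfolding nsq_def by (intro sum_pos2[of _ i]) auto
qed

lemma vecs_zero [simp]: "(\<lambda>_. 0) \<in> vecs n"
  by (simp add: vecs_def)

lemma vecs_add [intro]: "x \<in> vecs n \<Longrightarrow> y \<in> vecs n \<Longrightarrow> (\<lambda>i. x i + y i) \<in> vecs n"
  by (simp add: vecs_def)

lemma vecs_scale [intro]: "x \<in> vecs n \<Longrightarrow> (\<lambda>i. c * x i) \<in> vecs n"
  by (simp add: vecs_def)

lemma unitv_vecs [simp]: "i < n \<Longrightarrow> unitv i \<in> vecs n"
  by (simp add: vecs_def unitv_def)

lemma ip_unitv_right [simp]: "i < n \<Longrightarrow> ip n x (unitv i) = x i"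
  by (simp add: ip_def unitv_def if_distrib cong: if_cong)

lemma ip_unitv_left [simp]: "i < n \<Longrightarrow> ip n (unitv i) x = cnj (x i)"
  by (metis cnj_ip ip_unitv_right)

lemma vecs_eqI:
  assumes "x \<in> vecs n" "y \<in> vecs n" "\<And>z. z \<in> vecs n \<Longrightarrow> ip n x z = ip n y z"
  shows "x = y"
proof
  fix i
  show "x i = y i"
  proof (cases "i < n")
    case True
    then show ?thesis using assms(3)[of "unitv i"] by simp
  qed (use assms(1,2) in \<open>simp add: vecs_def\<close>)
qed

section \<open>Self-adjoint and positive definite operators\<close>

definition selfadj :: "nat \<Rightarrow> ((nat \<Rightarrow> complex) \<Rightarrow> nat \<Rightarrow> complex) \<Rightarrow> bool" where
  "selfadj n B \<longleftrightarrow> (\<forall>x\<in>vecs n. B x \<in> vecs n) \<and>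
     (\<forall>x\<in>vecs n. \<forall>y\<in>vecs n. ip n (B x) y = ip n x (B y))"

definition posdef :: "nat \<Rightarrow> ((nat \<Rightarrow> complex) \<Rightarrow> nat \<Rightarrow> complex) \<Rightarrow> bool" where
  "posdef n B \<longleftrightarrow> selfadj n B \<and> (\<forall>x\<in>vecs n. x \<noteq> (\<lambda>_. 0) \<longrightarrow> 0 < Re (ip n (B x) x))"

text \<open>Inverses are carried along as explicit witnesses. The argument starts from the identity
  and builds every further inverse by rank-one updates, so no general inversion theorem is
  invoked.\<close>

definition pd_inverse :: "nat \<Rightarrow> ((nat \<Rightarrow> complex) \<Rightarrow> nat \<Rightarrow> complex) \<Rightarrow>
    ((nat \<Rightarrow> complex) \<Rightarrow> nat \<Rightarrow> complex) \<Rightarrow> bool" where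
  "pd_inverse n B P \<longleftrightarrow> posdef n B \<and> (\<forall>x\<in>vecs n. P x \<in> vecs n \<and> B (P x) = x \<and> P (B x) = x)"

definition optrace :: "nat \<Rightarrow> ((nat \<Rightarrow> complex) \<Rightarrow> nat \<Rightarrow> complex) \<Rightarrow> real" where
  "optrace n P = (\<Sum>i<n. Re (P (unitv i) i))"

lemma selfadj_vecs: "selfadj n B \<Longrightarrow> x \<in> vecs n \<Longrightarrow> B x \<in> vecs n"
  by (simp add: selfadj_def)

lemma selfadj_ip: "selfadj n B \<Longrightarrow> x \<in> vecs n \<Longrightarrow> y \<in> vecs n \<Longrightarrow> ip n (B x) y = ip n x (B y)"
  by (simp add: selfadj_def)

text \<open>Moving \<open>B\<close> to the other side of the inner product leaves an expression that
  is linear in the argument, and inner products separate the points of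
  \<open>vecs n\<close>.\<close>

lemma selfadj_linear:
  assumes "selfadj n B" "x \<in> vecs n" "y \<in> vecs n"
  shows "B (\<lambda>i. x i + c * y i) = (\<lambda>i. B x i + c * B y i)"
proof (rule vecs_eqI)
  fix z assume z: "z \<in> vecs n"
  have "(\<lambda>i. x i + c * y i) \<in> vecs n" using assms by (intro vecs_add vecs_scale)
  then show "ip n (B (\<lambda>i. x i + c * y i)) z = ip n (\<lambda>i. B x i + c * B y i) z"
    using assms z by (simp add: selfadj_ip ip_linear)
qed (use assms in \<open>auto intro!: vecs_add vecs_scale selfadj_vecs[OF assms(1)]\<close>)

lemma selfadj_zero: "selfadj n B \<Longrightarrow> B (\<lambda>_. 0) = (\<lambda>_. 0)"
  using selfadj_linear[of n B "\<lambda>_. 0" "\<lambda>_. 0" 1] by (simp add: fun_eq_iff)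

lemma selfadj_ip_real:
  assumes "selfadj n B" "x \<in> vecs n"
  shows "ip n (B x) x = of_real (Re (ip n (B x) x))" "ip n x (B x) = of_real (Re (ip n (B x) x))"
proof -
  have "cnj (ip n (B x) x) = ip n (B x) x" by (metis assms cnj_ip selfadj_ip)
  then show "ip n (B x) x = of_real (Re (ip n (B x) x))"
    by (metis Reals_cnj_iff of_real_Re)
  then show "ip n x (B x) = of_real (Re (ip n (B x) x))"
    using assms by (simp add: selfadj_ip)
qed

lemma posdef_nonneg: "posdef n B \<Longrightarrow> x \<in> vecs n \<Longrightarrow> 0 \<le> Re (ip n (B x) x)"
  by (cases "x = (\<lambda>_. 0)") (auto simp: posdef_def intro: less_imp_le)

text \<open>This is Cauchy-Schwarz for the inner product induced by \<open>B\<close>. Later it is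
  applied with one argument in the image of an inverse of \<open>B\<close>, which turns it into a
  comparison between \<open>B\<close> and that inverse.\<close>

lemma posdef_Cauchy_Schwarz:
  assumes B: "posdef n B" and x: "x \<in> vecs n" and y: "y \<in> vecs n"
  shows "(cmod (ip n (B x) y))\<^sup>2 \<le> Re (ip n (B x) x) * Re (ip n (B y) y)"
proof (cases "y = (\<lambda>_. 0)")
  case True
  then show ?thesis by simp
next
  case False
  have sa: "selfadj n B" using B by (simp add: posdef_def)
  define b where "b = Re (ip n (B y) y)"
  have b: "b > 0" using B y False by (simp add: b_def posdef_def)
  have byy: "ip n (B y) y = of_real b"
    unfolding b_def by (rule selfadj_ip_real[OF sa y])
  define w where "w = ip n (B x) y"
  have yx: "ip n (B y) x = cnj w"
    unfolding w_def by (simp add: cnj_ip selfadj_ip[OF sa y x])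
  \<comment> \<open>This coefficient minimises the quadratic form of \<open>B\<close> along the line
    \<open>x + c y\<close>; the minimum is still nonnegative.\<close>
  define c where "c = - w / of_real b"
  have zv: "(\<lambda>i. x i + c * y i) \<in> vecs n" using x y by (intro vecs_add vecs_scale)
  have "ip n (B (\<lambda>i. x i + c * y i)) (\<lambda>i. x i + c * y i)
      = ip n (B x) x + cnj c * w + c * cnj w + c * cnj c * of_real b"
    by (simp add: selfadj_linear[OF sa x y] ip_linear yx byy algebra_simps flip: w_def)
  also have "\<dots> = ip n (B x) x - w * cnj w / of_real b"
    using b by (simp add: c_def field_simps)
  also have "\<dots> = ip n (B x) x - of_real ((cmod w)\<^sup>2 / b)"
    by (simp add: complex_norm_square[symmetric])
  finally have "0 \<le> Re (ip n (B x) x) - (cmod w)\<^sup>2 / b"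
    using posdef_nonneg[OF B zv] by simp
  then show ?thesis using b by (simp add: field_simps b_def w_def)
qed

lemma
  assumes "pd_inverse n B P"
  shows pd_inverse_posdef: "posdef n B"
    and pd_inverse_selfadj: "selfadj n B"
    and pd_inverse_vecs: "x \<in> vecs n \<Longrightarrow> P x \<in> vecs n"
    and pd_inverse_right: "x \<in> vecs n \<Longrightarrow> B (P x) = x"
    and pd_inverse_left: "x \<in> vecs n \<Longrightarrow> P (B x) = x"
  using assms by (auto simp: pd_inverse_def posdef_def)

text \<open>Since \<open>x = B (P x)\<close>, the form of \<open>P\<close> at \<open>x\<close> is
  the form of \<open>B\<close> at \<open>P x\<close>.\<close>

lemma posdef_inverse:
  assumes I: "pd_inverse n B P"
  shows "posdef n P"
  unfolding posdef_def selfadj_def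
proof (intro conjI ballI impI)
  note sa = pd_inverse_selfadj[OF I]
  fix x assume x: "x \<in> vecs n"
  note Px = pd_inverse_vecs[OF I x]
  show "P x \<in> vecs n" by (rule Px)
  show "ip n (P x) y = ip n x (P y)" if y: "y \<in> vecs n" for y
    using selfadj_ip[OF sa Px pd_inverse_vecs[OF I y]]
    by (simp add: pd_inverse_right[OF I] x y)
  assume "x \<noteq> (\<lambda>_. 0)"
  then have "P x \<noteq> (\<lambda>_. 0)"
    using pd_inverse_right[OF I x] selfadj_zero[OF sa] by metis
  then have "0 < Re (ip n (B (P x)) (P x))"
    using pd_inverse_posdef[OF I] Px by (simp add: posdef_def)
  then show "0 < Re (ip n (P x) x)"
    by (simp add: pd_inverse_right[OF I x] Re_ip_commute)
qed

lemma selfadj_inverse: "pd_inverse n B P \<Longrightarrow> selfadj n P"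
  using posdef_inverse by (auto simp: posdef_def)

lemma optrace_nonneg: 
  assumes "posdef n P"
  shows "0 \<le> optrace n P"
  unfolding optrace_def
proof (intro sum_nonneg)
  fix i assume "i \<in> {..<n}"
  then show "0 \<le> Re (P (unitv i) i)"
    using posdef_nonneg[OF assms, of "unitv i"] by simp
qed

lemma optrace_pos: 
  assumes "posdef n P" "n > 0"
  shows "0 < optrace n P"
  unfolding optrace_def
proof (intro sum_pos)
  fix i assume i: "i \<in> {..<n}"
  have "unitv i \<noteq> (\<lambda>_. 0)" by (auto simp: unitv_def fun_eq_iff)
  with i assms(1) have "0 < Re (ip n (P (unitv i)) (unitv i))"
    unfolding posdef_def by (metis lessThan_iff unitv_vecs)
  with i show "0 < Re (P (unitv i) i)" by simp
qed (use assms in auto)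

section \<open>Rank-one updates\<close>

text \<open>The updated form is \<open>\<langle>B x, x\<rangle> + s |\<langle>x,
  v\<rangle>|\<^sup>2\<close>. Because \<open>B (P v) = v\<close>, Cauchy-Schwarz for
  \<open>B\<close> gives \<open>|\<langle>x, v\<rangle>|\<^sup>2 \<le> \<langle>B x, x\<rangle>
  \<langle>P v, v\<rangle>\<close>, so for negative \<open>s\<close> at least the fraction
  \<open>1 + s \<langle>P v, v\<rangle>\<close> of the form survives.\<close>

lemma posdef_rank_one:
  assumes I: "pd_inverse n B P" and v: "v \<in> vecs n"
    and s: "0 < 1 + s * Re (ip n (P v) v)"
  shows "posdef n (\<lambda>x i. B x i + of_real s * ip n x v * v i)"
  unfolding posdef_def selfadj_def
proof (intro conjI ballI impI)
  note sa = pd_inverse_selfadj[OF I]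
  fix x assume x: "x \<in> vecs n"
  show "(\<lambda>i. B x i + of_real s * ip n x v * v i) \<in> vecs n"
    by (intro vecs_add vecs_scale v selfadj_vecs[OF sa x])
  show "ip n (\<lambda>i. B x i + of_real s * ip n x v * v i) y
      = ip n x (\<lambda>i. B y i + of_real s * ip n y v * v i)" if y: "y \<in> vecs n" for y
    using selfadj_ip[OF sa x y] by (simp add: ip_linear cnj_ip)
  assume x0: "x \<noteq> (\<lambda>_. 0)"
  have q: "0 < Re (ip n (B x) x)"
    using pd_inverse_posdef[OF I] x x0 by (simp add: posdef_def)
  have eq: "Re (ip n (\<lambda>i. B x i + of_real s * ip n x v * v i) x)
      = Re (ip n (B x) x) + s * (cmod (ip n x v))\<^sup>2"
    by (simp add: ip_linear mult.assoc ip_mult_cnj del: of_real_power)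
  have "(cmod (ip n (B x) (P v)))\<^sup>2 \<le> Re (ip n (B x) x) * Re (ip n (B (P v)) (P v))"
    by (rule posdef_Cauchy_Schwarz[OF pd_inverse_posdef[OF I] x pd_inverse_vecs[OF I v]])
  also have "ip n (B x) (P v) = ip n x v"
    by (simp add: selfadj_ip[OF sa x pd_inverse_vecs[OF I v]] pd_inverse_right[OF I v])
  also have "Re (ip n (B (P v)) (P v)) = Re (ip n (P v) v)"
    by (simp add: pd_inverse_right[OF I v] Re_ip_commute)
  finally have cs: "(cmod (ip n x v))\<^sup>2 \<le> Re (ip n (B x) x) * Re (ip n (P v) v)" .
  show "0 < Re (ip n (\<lambda>i. B x i + of_real s * ip n x v * v i) x)"
  proof (cases "s \<ge> 0")
    case True
    then show ?thesis using q by (simp add: eq add_pos_nonneg)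
  next
    case False
    then have "s * (Re (ip n (B x) x) * Re (ip n (P v) v)) \<le> s * (cmod (ip n x v))\<^sup>2"
      using cs by (intro mult_left_mono_neg) auto
    moreover have "0 < Re (ip n (B x) x) * (1 + s * Re (ip n (P v) v))"
      using q s by simp
    ultimately show ?thesis unfolding eq by (simp add: algebra_simps)
  qed
qed

text \<open>The inverse changes by a multiple of the rank-one operator
  \<open>x \<mapsto> \<langle>x, P v\<rangle> P v\<close>, whose trace is
  \<open>|P v|\<^sup>2\<close>; this explains the trace formula.\<close>

lemma Sherman_Morrison:
  assumes I: "pd_inverse n B P" and v: "v \<in> vecs n"
    and s: "0 < 1 + s * Re (ip n (P v) v)"
  obtains P' where "pd_inverse n (\<lambda>x i. B x i + of_real s * ip n x v * v i) P'"
    "optrace n P' = optrace n P - s / (1 + s * Re (ip n (P v) v)) * nsq n (P v)"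
proof -
  note sa = pd_inverse_selfadj[OF I] and sp = selfadj_inverse[OF I]
  note Pv = pd_inverse_vecs[OF I v]
  define p where "p = Re (ip n (P v) v)"
  have p: "ip n (P v) v = of_real p" "ip n v (P v) = of_real p"
    unfolding p_def by (rule selfadj_ip_real[OF sp v])+
  \<comment> \<open>In both products \<open>B' P'\<close> and \<open>P' B'\<close> the rank-one term
    has coefficient \<open>s - r (1 + s p)\<close>; this choice of \<open>r\<close> makes it
    vanish.\<close>
  define r where "r = s / (1 + s * p)"
  have "r * (1 + s * p) = s" using s by (simp add: r_def p_def)
  then have r: "complex_of_real r * (1 + of_real s * of_real p) = of_real s"
    by (metis of_real_1 of_real_add of_real_mult)
  define B' where "B' = (\<lambda>x i. B x i + of_real s * ip n x v * v i)"
  define P' where "P' = (\<lambda>x i. P x i + (- of_real r * ip n x (P v)) * P v i)"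
  have "pd_inverse n B' P'"
    unfolding pd_inverse_def
  proof (intro conjI ballI)
    show "posdef n B'" unfolding B'_def by (rule posdef_rank_one[OF I v s])
    fix x assume x: "x \<in> vecs n"
    note Px = pd_inverse_vecs[OF I x] and Bx = selfadj_vecs[OF sa x]
    show "P' x \<in> vecs n"
      unfolding P'_def by (intro vecs_add vecs_scale Px Pv)
    have "B (P' x) = (\<lambda>i. x i + (- of_real r * ip n x (P v)) * v i)"
      unfolding P'_def
      by (subst selfadj_linear[OF sa Px Pv]) (simp add: pd_inverse_right[OF I] x v)
    moreover have "ip n (P' x) v = ip n x (P v) * (1 - of_real r * of_real p)"
      unfolding P'_def ip_add_left ip_scale_left p selfadj_ip[OF sp x v] by (simp add: algebra_simps)
    ultimately have "B' (P' x) = (\<lambda>i. x i + (of_real s - of_real r * (1 + of_real s * of_real p))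
        * ip n x (P v) * v i)"
      unfolding B'_def fun_eq_iff by (simp only: fun_eq_iff) (simp add: algebra_simps)
    then show "B' (P' x) = x" by (simp add: r)
    have "P (B' x) = (\<lambda>i. x i + of_real s * ip n x v * P v i)"
      unfolding B'_def
      by (subst selfadj_linear[OF sp Bx v]) (simp add: pd_inverse_left[OF I] x)
    moreover have "ip n (B' x) (P v) = ip n x v * (1 + of_real s * of_real p)"
      unfolding B'_def ip_add_left ip_scale_left p selfadj_ip[OF sa x Pv] pd_inverse_right[OF I v]
      by (simp add: algebra_simps)
    ultimately have "P' (B' x) = (\<lambda>i. x i + (of_real s - of_real r * (1 + of_real s * of_real p))
        * ip n x v * P v i)"
      unfolding P'_def fun_eq_iff by (simp only: fun_eq_iff) (simp add: algebra_simps)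
    then show "P' (B' x) = x" by (simp add: r)
  qed
  moreover have "optrace n P' = optrace n P - r * nsq n (P v)"
  proof -
    have "Re (P' (unitv i) i) = Re (P (unitv i) i) - r * (cmod (P v i))\<^sup>2" if "i < n" for i
    proof -
      have "P' (unitv i) i = P (unitv i) i - of_real (r * (cmod (P v i))\<^sup>2)"
        unfolding P'_def of_real_mult complex_norm_square using that by (simp add: mult_ac)
      then show ?thesis by simp
    qed
    then show ?thesis
      by (simp add: optrace_def nsq_def sum_subtractf sum_distrib_left)
  qed
  ultimately show ?thesis using that unfolding B'_def r_def p_def by blast
qed

section \<open>Scalar shifts and their effect on the trace of the inverse\<close>

text \<open>The smallest eigenvalue of \<open>B\<close> is at least the reciprocal of the trace of
  its inverse. Coordinatewise, \<open>x i\<close> is the \<open>B\<close>-inner product of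
  \<open>x\<close> and \<open>P (unitv i)\<close>, and Cauchy-Schwarz produces the diagonal entries
  of \<open>P\<close>, which are then summed.\<close>

lemma nsq_le_optrace_inverse:
  assumes I: "pd_inverse n B P" and x: "x \<in> vecs n"
  shows "nsq n x \<le> optrace n P * Re (ip n (B x) x)"
proof -
  have "(cmod (x i))\<^sup>2 \<le> Re (P (unitv i) i) * Re (ip n (B x) x)" if i: "i < n" for i
  proof -
    have u: "unitv i \<in> vecs n" using i by simp
    note Pu = pd_inverse_vecs[OF I u]
    have "ip n (B x) (P (unitv i)) = x i"
      using i by (simp add: selfadj_ip[OF pd_inverse_selfadj[OF I] x Pu] pd_inverse_right[OF I u])
    moreover have "Re (ip n (B (P (unitv i))) (P (unitv i))) = Re (P (unitv i) i)"
      using i by (simp add: pd_inverse_right[OF I u])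
    ultimately show ?thesis
      using posdef_Cauchy_Schwarz[OF pd_inverse_posdef[OF I] x Pu] by (simp add: mult.commute)
  qed
  then show ?thesis
    unfolding nsq_def optrace_def sum_distrib_right by (intro sum_mono) auto
qed

text \<open>The scalar shift is reached by \<open>n\<close> rank-one updates along the coordinate axes; each partial
  shift lies between the two positive definite endpoints.\<close>

lemma pd_inverse_shift:
  assumes I: "pd_inverse n B P" and B': "posdef n (\<lambda>x i. B x i + of_real \<delta> * x i)"
  obtains P' where "pd_inverse n (\<lambda>x i. B x i + of_real \<delta> * x i) P'"
proof -
  \<comment> \<open>Stage \<open>k\<close> shifts only the coordinates below \<open>k\<close>: stage
    \<open>0\<close> is \<open>B\<close>, and stage \<open>n\<close> agrees with the full shift on
    \<open>vecs n\<close>.\<close>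
  define C where "C = (\<lambda>k x i. B x i + of_real \<delta> * (if i < k then x i else 0))"
  have "\<exists>P'. pd_inverse n (C k) P'" if "k \<le> n" for k
    using that
  proof (induction k)
    case 0
    have "C 0 = B" by (simp add: C_def)
    then show ?case using I by auto
  next
    case (Suc k)
    then obtain P1 where P1: "pd_inverse n (C k) P1" by auto
    have k: "k < n" using Suc by simp
    \<comment> \<open>At this vector the form of the next stage takes the value
      \<open>p * (1 + \<delta> * p)\<close>, where \<open>p\<close> is the \<open>k\<close>-th
      diagonal entry of \<open>P1\<close>. Positivity there yields the condition required by
      \<open>Sherman_Morrison\<close>.\<close>
    define x where "x = P1 (unitv k)"
    have x: "x \<in> vecs n" using pd_inverse_vecs[OF P1] k by (simp add: x_def)
    have Cx: "C k x = unitv k" unfolding x_def using k by (simp add: pd_inverse_right[OF P1])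
    have x0: "x \<noteq> (\<lambda>_. 0)"
    proof
      assume "x = (\<lambda>_. 0)"
      then have "unitv k = (\<lambda>_. 0)"
        using selfadj_zero[OF pd_inverse_selfadj[OF P1]] Cx by simp
      then show False by (metis unitv_def zero_neq_one)
    qed
    define p where "p = Re (ip n x (unitv k))"
    have pp: "0 < p"
      using pd_inverse_posdef[OF P1] x x0 Cx unfolding p_def posdef_def
      by (metis Re_ip_commute)
    have xk: "x k = of_real p"
      using selfadj_ip_real(1)[OF selfadj_inverse[OF P1] unitv_vecs[OF k]] k
      by (simp add: p_def x_def)
    have CS: "C (Suc k) = (\<lambda>x i. C k x i + of_real \<delta> * ip n x (unitv k) * unitv k i)"
      unfolding C_def ip_unitv_right[OF k] by (auto simp: fun_eq_iff unitv_def less_Suc_eq)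
    have partial: "Re (ip n (C (Suc k) x) x) = Re (ip n (B x) x) + \<delta> * nsq (Suc k) x"
    proof -
      have "ip n (\<lambda>i. if i < Suc k then x i else 0) x = ip (Suc k) x x"
        unfolding ip_def using k by (intro sum.mono_neutral_cong_right) auto
      then show ?thesis
        by (simp add: C_def ip_linear ip_self)
    qed
    \<comment> \<open>The partial shift is bounded below by \<open>B\<close> for nonnegative
      \<open>\<delta>\<close> and by the full shift for negative \<open>\<delta>\<close>.\<close>
    have "nsq (Suc k) x \<le> nsq n x"
      unfolding nsq_def using k by (intro sum_mono2) auto
    then have "0 < Re (ip n (B x) x) + \<delta> * nsq (Suc k) x"
    proof (cases "\<delta> \<ge> 0")
      case True
      moreover have "0 < Re (ip n (B x) x)"
        using pd_inverse_posdef[OF I] x x0 by (simp add: posdef_def)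
      ultimately show ?thesis by (simp add: add_pos_nonneg nsq_nonneg)
    next
      case False
      assume "nsq (Suc k) x \<le> nsq n x"
      with False have "\<delta> * nsq n x \<le> \<delta> * nsq (Suc k) x" by (intro mult_left_mono_neg) auto
      moreover have "0 < Re (ip n (\<lambda>i. B x i + of_real \<delta> * x i) x)"
        using B' x x0 by (simp add: posdef_def)
      ultimately show ?thesis by (simp add: ip_linear ip_self)
    qed
    also have "Re (ip n (B x) x) + \<delta> * nsq (Suc k) x = p * (1 + \<delta> * p)"
      using k by (simp flip: partial add: CS Cx ip_linear xk algebra_simps)
    finally have "0 < 1 + \<delta> * p" using pp by (simp add: zero_less_mult_iff)
    then obtain P2 where "pd_inverse n (C (Suc k)) P2"
      using Sherman_Morrison[OF P1 unitv_vecs[OF k], of \<delta>]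
      unfolding CS p_def x_def by blast
    then show ?case by blast
  qed
  then obtain P' where P': "pd_inverse n (C n) P'" by blast
  \<comment> \<open>The two operators agree on \<open>vecs n\<close> but may differ elsewhere, so
    the inverse is transferred pointwise instead of identifying the functions.\<close>
  have "C n x = (\<lambda>i. B x i + of_real \<delta> * x i)" if "x \<in> vecs n" for x
    using that by (auto simp: C_def fun_eq_iff vecs_def)
  then have "pd_inverse n (\<lambda>x i. B x i + of_real \<delta> * x i) P'"
    using P' B' by (auto simp: pd_inverse_def selfadj_vecs posdef_def)
  then show ?thesis by (rule that)
qed

text \<open>The resolvent identity \<open>P = P' + \<delta> P P'\<close>, used twice, gives
  \<open>P = P' + \<delta> P' P' + \<delta>\<^sup>2 P' P P'\<close>. The last term has a nonnegative
  diagonal for either sign of \<open>\<delta>\<close> and is dropped. The sum in the conclusion is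
  the trace of \<open>P' P'\<close>.\<close>

lemma optrace_shift_le:
  assumes I: "pd_inverse n B P" and I': "pd_inverse n (\<lambda>x i. B x i + of_real \<delta> * x i) P'"
  shows "optrace n P' \<le> optrace n P - \<delta> * (\<Sum>i<n. nsq n (P' (unitv i)))"
proof -
  note sp = selfadj_inverse[OF I] and sp' = selfadj_inverse[OF I']
  have res: "P x = (\<lambda>i. P' x i + of_real \<delta> * P (P' x) i)" if x: "x \<in> vecs n" for x
  proof -
    note P'x = pd_inverse_vecs[OF I' x]
    have "P x = P (\<lambda>i. B (P' x) i + of_real \<delta> * P' x i)"
      using pd_inverse_right[OF I' x] by simp
    also have "\<dots> = (\<lambda>i. P' x i + of_real \<delta> * P (P' x) i)"
      by (simp add: selfadj_linear[OF sp selfadj_vecs[OF pd_inverse_selfadj[OF I] P'x] P'x]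
          pd_inverse_left[OF I P'x])
    finally show ?thesis .
  qed
  have "Re (P' (unitv i) i) \<le> Re (P (unitv i) i) - \<delta> * nsq n (P' (unitv i))" if i: "i < n" for i
  proof -
    define z where "z = P' (unitv i)"
    have u: "unitv i \<in> vecs n" using i by simp
    have z: "z \<in> vecs n" unfolding z_def by (rule pd_inverse_vecs[OF I' u])
    have "P z i = ip n z (P (unitv i))"
      using i selfadj_ip[OF sp z u] by simp
    also have "\<dots> = of_real (nsq n z) + of_real \<delta> * ip n z (P z)"
      by (subst res[OF u]) (simp add: ip_linear ip_self flip: z_def)
    finally have "Re (P z i) = nsq n z + \<delta> * Re (ip n (P z) z)"
      by (simp add: Re_ip_commute)
    moreover have "Re (P (unitv i) i) = Re (z i) + \<delta> * Re (P z i)"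
      by (subst res[OF u]) (simp flip: z_def)
    moreover have "0 \<le> \<delta>\<^sup>2 * Re (ip n (P z) z)"
      using posdef_nonneg[OF posdef_inverse[OF I] z] by simp
    ultimately show ?thesis
      by (simp add: algebra_simps power2_eq_square flip: z_def)
  qed
  then show ?thesis
    unfolding optrace_def sum_distrib_left sum_subtractf[symmetric] by (intro sum_mono) auto
qed

lemma posdef_shift:
  assumes B: "selfadj n B" and pos: "\<And>x. x \<in> vecs n \<Longrightarrow> x \<noteq> (\<lambda>_. 0) \<Longrightarrow> 0 < Re (ip n (B x) x) + \<delta> * nsq n x"
  shows "posdef n (\<lambda>x i. B x i + of_real \<delta> * x i)"
  unfolding posdef_def selfadj_def
proof (intro conjI ballI impI)
  fix x assume x: "x \<in> vecs n"
  show "(\<lambda>i. B x i + of_real \<delta> * x i) \<in> vecs n"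
    by (intro vecs_add vecs_scale x selfadj_vecs[OF B x])
  show "ip n (\<lambda>i. B x i + of_real \<delta> * x i) y = ip n x (\<lambda>i. B y i + of_real \<delta> * y i)"
    if y: "y \<in> vecs n" for y
    using selfadj_ip[OF B x y] by (simp add: ip_linear)
  assume "x \<noteq> (\<lambda>_. 0)"
  then show "0 < Re (ip n (\<lambda>i. B x i + of_real \<delta> * x i) x)"
    using pos[OF x] by (simp add: ip_linear ip_self)
qed

lemma pd_inverse_shift_up:
  assumes I: "pd_inverse n B P" and d: "\<delta> \<ge> 0"
  obtains P' where "pd_inverse n (\<lambda>x i. B x i + of_real \<delta> * x i) P'"
    "optrace n P' \<le> optrace n P - \<delta> * (\<Sum>i<n. nsq n (P' (unitv i)))"
proof -
  have "posdef n (\<lambda>x i. B x i + of_real \<delta> * x i)"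
    using pd_inverse_posdef[OF I] d
    by (intro posdef_shift) (auto simp: posdef_def nsq_nonneg intro!: add_pos_nonneg)
  then obtain P' where "pd_inverse n (\<lambda>x i. B x i + of_real \<delta> * x i) P'"
    by (rule pd_inverse_shift[OF I])
  with that optrace_shift_le[OF I] show ?thesis by blast
qed

text \<open>By \<open>nsq_le_optrace_inverse\<close> the bound on \<open>\<delta>\<close> means
  \<open>\<delta> I \<le> B / 2\<close>. Hence the shifted operator is at least
  \<open>B / 2\<close>, so it stays positive definite, and the trace of the inverse at most
  doubles.\<close>

lemma pd_inverse_shift_down:
  assumes I: "pd_inverse n B P" and d: "\<delta> \<ge> 0" "\<delta> * optrace n P \<le> 1 / 2"
  obtains P' where "pd_inverse n (\<lambda>x i. B x i - of_real \<delta> * x i) P'"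
    "optrace n P' \<le> optrace n P + \<delta> * (\<Sum>i<n. nsq n (P' (unitv i)))"
    "optrace n P' \<le> 2 * optrace n P"
proof -
  have half: "Re (ip n (B x) x) / 2 \<le> Re (ip n (B x) x) - \<delta> * nsq n x" if x: "x \<in> vecs n" for x
  proof -
    have "\<delta> * nsq n x \<le> (\<delta> * optrace n P) * Re (ip n (B x) x)"
      using mult_left_mono[OF nsq_le_optrace_inverse[OF I x] d(1)] by (simp add: mult.assoc)
    also have "\<dots> \<le> 1 / 2 * Re (ip n (B x) x)"
      by (intro mult_right_mono d posdef_nonneg[OF pd_inverse_posdef[OF I] x])
    finally show ?thesis by simp
  qed
  have neg: "(\<lambda>x i. B x i - of_real \<delta> * x i) = (\<lambda>x i. B x i + of_real (-\<delta>) * x i)"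
    by simp
  have "posdef n (\<lambda>x i. B x i + of_real (-\<delta>) * x i)"
  proof (intro posdef_shift pd_inverse_selfadj[OF I])
    fix x assume x: "x \<in> vecs n" "x \<noteq> (\<lambda>_. 0)"
    then have "0 < Re (ip n (B x) x)"
      using pd_inverse_posdef[OF I] by (simp add: posdef_def)
    with half[OF x(1)] show "0 < Re (ip n (B x) x) + (-\<delta>) * nsq n x" by simp
  qed
  then obtain P' where I': "pd_inverse n (\<lambda>x i. B x i + of_real (-\<delta>) * x i) P'"
    by (rule pd_inverse_shift[OF I])
  \<comment> \<open>With \<open>y = P' (unitv i)\<close>, the entry \<open>y i\<close> is the
    shifted form at \<open>y\<close>, so \<open>\<langle>B y, y\<rangle> \<le> 2 y i\<close>.
    Cauchy-Schwarz for \<open>B\<close> bounds \<open>(y i)\<^sup>2\<close> by the diagonal entry of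
    \<open>P\<close> times \<open>\<langle>B y, y\<rangle>\<close>, and one factor
    \<open>y i\<close> cancels.\<close>
  have "Re (P' (unitv i) i) \<le> 2 * Re (P (unitv i) i)" if i: "i < n" for i
  proof -
    have u: "unitv i \<in> vecs n" using i by simp
    define y where "y = P' (unitv i)"
    have y: "y \<in> vecs n" unfolding y_def by (rule pd_inverse_vecs[OF I' u])
    have b: "Re (ip n (B y) y) \<le> 2 * Re (y i)"
    proof -
      have "ip n (\<lambda>j. B y j + of_real (-\<delta>) * y j) y = cnj (y i)"
        unfolding y_def using pd_inverse_right[OF I' u] i by simp
      then have "Re (ip n (B y) y) - \<delta> * nsq n y = Re (y i)"
        by (simp add: ip_linear ip_self complex_eq_iff)
      with half[OF y] show ?thesis by simp
    qed
    note Pu = pd_inverse_vecs[OF I u]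
    have yi: "y i = of_real (Re (y i))"
      using selfadj_ip_real(1)[OF selfadj_inverse[OF I'] u] i unfolding y_def by simp
    have yi0: "0 \<le> Re (y i)"
      using posdef_nonneg[OF posdef_inverse[OF I'] u] i unfolding y_def by simp
    have Pi0: "0 \<le> Re (P (unitv i) i)"
      using posdef_nonneg[OF posdef_inverse[OF I] u] i by simp
    have "(cmod (ip n (B (P (unitv i))) y))\<^sup>2
        \<le> Re (ip n (B (P (unitv i))) (P (unitv i))) * Re (ip n (B y) y)"
      by (rule posdef_Cauchy_Schwarz[OF pd_inverse_posdef[OF I] Pu y])
    then have "(cmod (y i))\<^sup>2 \<le> Re (P (unitv i) i) * Re (ip n (B y) y)"
      using i by (simp add: pd_inverse_right[OF I u])
    also have "\<dots> \<le> Re (P (unitv i) i) * (2 * Re (y i))"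
      by (intro mult_left_mono b Pi0)
    also have "cmod (y i) = Re (y i)"
      by (subst yi) (use yi0 in \<open>simp del: of_real_Re\<close>)
    finally have "Re (y i) * Re (y i) \<le> (2 * Re (P (unitv i) i)) * Re (y i)"
      by (simp add: power2_eq_square mult_ac)
    then show ?thesis using yi0 Pi0 unfolding y_def[symmetric]
      by (cases "Re (y i) = 0") auto
  qed
  then have "optrace n P' \<le> 2 * optrace n P"
    unfolding optrace_def sum_distrib_left by (intro sum_mono) auto
  moreover have "optrace n P' \<le> optrace n P + \<delta> * (\<Sum>i<n. nsq n (P' (unitv i)))"
    using optrace_shift_le[OF I I'] by simp
  ultimately show ?thesis using I' that unfolding neg by blast
qed

section \<open>Averaging over an isotropic family\<close>

lemma optrace_eq_ip: "optrace n P = Re (\<Sum>i<n. ip n (unitv i) (P (unitv i)))"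
  by (simp add: optrace_def)

text \<open>This is the entrywise form of the second-moment identity.
  \<open>has_bochner_integral\<close> records integrability along with the value.\<close>

definition isotropic :: "'a measure \<Rightarrow> nat \<Rightarrow> ('a \<Rightarrow> nat \<Rightarrow> complex) \<Rightarrow> bool" where
  "isotropic M n v \<longleftrightarrow> (\<forall>x. v x \<in> vecs n) \<and>
     (\<forall>i<n. \<forall>j<n. has_bochner_integral M (\<lambda>x. v x i * cnj (v x j)) (if i = j then 1 else 0))"

text \<open>Expanding both inner products leaves a finite combination of second moments. Suitable
  choices of \<open>a\<close> and \<open>b\<close> give the averages of \<open>|P v|\<^sup>2\<close>
  and \<open>\<langle>P v, v\<rangle>\<close> below.\<close>

lemma isotropic_ip:
  assumes "isotropic M n v"
  shows "has_bochner_integral M (\<lambda>x. ip n (v x) a * ip n b (v x)) (ip n b a)"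
proof -
  have "has_bochner_integral M
      (\<lambda>x. \<Sum>i<n. \<Sum>j<n. (cnj (a i) * b j) * (v x i * cnj (v x j)))
      (\<Sum>i<n. \<Sum>j<n. (cnj (a i) * b j) * (if i = j then 1 else 0))"
    using assms unfolding isotropic_def
    by (intro has_bochner_integral_sum has_bochner_integral_mult_right) auto
  moreover have "(\<Sum>i<n. \<Sum>j<n. (cnj (a i) * b j) * (if i = j then 1 else 0)) = ip n b a"
    by (simp add: ip_def if_distrib mult.commute cong: if_cong)
  moreover have "(\<Sum>i<n. \<Sum>j<n. (cnj (a i) * b j) * (v x i * cnj (v x j)))
      = ip n (v x) a * ip n b (v x)" for x
    unfolding ip_def sum_product by (intro sum.cong) (simp_all add: mult_ac)
  ultimately show ?thesis by simp
qed

text \<open>The \<open>i\<close>-th coordinate of \<open>P (v x)\<close> is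
  \<open>\<langle>v x, P (unitv i)\<rangle>\<close>. The mean is the trace of \<open>P P\<close>,
  the quantity by which the shifts change the potential.\<close>

lemma isotropic_nsq:
  assumes v: "isotropic M n v" and P: "selfadj n P"
  shows "has_bochner_integral M (\<lambda>x. nsq n (P (v x))) (\<Sum>i<n. nsq n (P (unitv i)))"
proof -
  have "has_bochner_integral M
      (\<lambda>x. Re (\<Sum>i<n. ip n (v x) (P (unitv i)) * ip n (P (unitv i)) (v x)))
      (Re (\<Sum>i<n. ip n (P (unitv i)) (P (unitv i))))"
    by (intro has_bochner_integral_bounded_linear[OF bounded_linear_Re]
        has_bochner_integral_sum isotropic_ip v)
  moreover have "Re (\<Sum>i<n. ip n (v x) (P (unitv i)) * ip n (P (unitv i)) (v x)) = nsq n (P (v x))" for x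
  proof -
    have "ip n (v x) (P (unitv i)) * ip n (P (unitv i)) (v x) = of_real ((cmod (P (v x) i))\<^sup>2)"
      if "i < n" for i
      unfolding ip_mult_cnj
      using selfadj_ip[OF P, of "v x" "unitv i"] v that by (simp add: isotropic_def)
    then show ?thesis by (simp add: nsq_def del: of_real_power)
  qed
  ultimately show ?thesis by (simp add: ip_self)
qed

lemma isotropic_quadratic:
  assumes v: "isotropic M n v" and P: "selfadj n P"
  shows "has_bochner_integral M (\<lambda>x. Re (ip n (P (v x)) (v x))) (optrace n P)"
proof -
  have "has_bochner_integral M
      (\<lambda>x. Re (\<Sum>i<n. ip n (v x) (P (unitv i)) * ip n (unitv i) (v x)))
      (Re (\<Sum>i<n. ip n (unitv i) (P (unitv i))))"
    by (intro has_bochner_integral_bounded_linear[OF bounded_linear_Re]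
        has_bochner_integral_sum isotropic_ip v)
  moreover have "(\<Sum>i<n. ip n (v x) (P (unitv i)) * ip n (unitv i) (v x)) = ip n (P (v x)) (v x)" for x
  proof -
    have "ip n (v x) (P (unitv i)) = P (v x) i" if "i < n" for i
      using selfadj_ip[OF P, of "v x" "unitv i"] v that by (simp add: isotropic_def)
    then show ?thesis by (simp add: ip_def[of n "P (v x)"])
  qed
  ultimately show ?thesis by (simp only: optrace_eq_ip)
qed

text \<open>If \<open>F\<close> were positive wherever \<open>Z\<close> holds and \<open>v\<close>
  is nonzero, it would be nonnegative with integral 0, hence zero almost everywhere. Then
  \<open>v\<close> would vanish almost everywhere, although \<open>|v|\<^sup>2\<close> has mean
  \<open>n\<close>. The greedy step later divides by a form at \<open>v x\<close>, so a nonzero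
  vector has to be found.\<close>

lemma isotropic_exists_nonpos:
  fixes F :: "'a \<Rightarrow> real"
  assumes v: "isotropic M n v" and n: "0 < n" and F: "has_bochner_integral M F 0"
    and F0: "\<And>x. v x = (\<lambda>_. 0) \<Longrightarrow> F x = 0" and Z: "AE x in M. Z x"
  obtains x where "x \<in> space M" "Z x" "v x \<noteq> (\<lambda>_. 0)" "F x \<le> 0"
proof (rule ccontr)
  assume "\<not> thesis"
  with that have pos: "\<And>x. x \<in> space M \<Longrightarrow> Z x \<Longrightarrow> v x \<noteq> (\<lambda>_. 0) \<Longrightarrow> F x > 0"
    by (meson linorder_not_less)
  have nonneg: "AE x in M. 0 \<le> F x"
    using Z AE_space
  proof eventually_elim
    case (elim x)
    then show ?case using pos[of x] F0[of x] by (cases "v x = (\<lambda>_. 0)") auto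
  qed
  have "AE x in M. F x = 0"
    using integral_nonneg_eq_0_iff_AE[OF _ nonneg] F by (simp add: has_bochner_integral_iff)
  then have "AE x in M. nsq n (v x) = 0"
    using Z AE_space
  proof eventually_elim
    case (elim x)
    then show ?case using pos[of x] by (cases "v x = (\<lambda>_. 0)") (auto simp: nsq_def)
  qed
  then have "integral\<^sup>L M (\<lambda>x. nsq n (v x)) = 0"
    by (rule integral_eq_zero_AE)
  moreover have "integral\<^sup>L M (\<lambda>x. nsq n (v x)) = (\<Sum>i<n. nsq n (unitv i))"
    using isotropic_nsq[OF v, of "\<lambda>x. x"] by (simp add: selfadj_def has_bochner_integral_iff)
  moreover have "nsq n (unitv i) = 1" if "i < n" for i
    using that by (simp add: nsq_def unitv_def if_distrib[of "\<lambda>c. (cmod c)\<^sup>2"] cong: if_cong)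
  ultimately show False using n by simp
qed

section \<open>The barrier argument\<close>

text \<open>Positive definiteness inside \<open>pd_inverse\<close> makes the barriers strict:
  \<open>l I < A < u I\<close>. The two traces share one budget, so a gain at one barrier can pay
  for a loss at the other.\<close>

definition barriers :: "nat \<Rightarrow> ((nat \<Rightarrow> complex) \<Rightarrow> nat \<Rightarrow> complex) \<Rightarrow> real \<Rightarrow> real \<Rightarrow> real \<Rightarrow> bool" where
  "barriers n A l u \<Phi> \<longleftrightarrow> (\<exists>P Q. pd_inverse n (\<lambda>x i. of_real u * x i - A x i) P \<and>
     pd_inverse n (\<lambda>x i. A x i - of_real l * x i) Q \<and> optrace n P + optrace n Q \<le> \<Phi>)"

text \<open>Both barriers move first; the weight \<open>t\<close> keeps
  \<open>t \<langle>P v, v\<rangle>\<close> and \<open>t \<langle>Q v, v\<rangle>\<close> below \<open>1/2\<close>, so the rank-one update changes the potential by at most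
  \<open>t (2 |P v|\<^sup>2 - 2/3 |Q v|\<^sup>2)\<close>. With these barrier speeds the total change,
  multiplied by \<open>\<langle>(P + Q) v, v\<rangle>\<close>, is a quadratic form in \<open>v\<close> of trace 0.\<close>

lemma barriers_step:
  assumes v: "isotropic M n v" and n: "0 < n" and Z: "AE x in M. Z x"
    and bar: "barriers n A l u (2 * real n)"
  obtains x t where "x \<in> space M" "Z x" "0 \<le> t"
    "barriers n (\<lambda>y i. A y i + of_real t * ip n y (v x) * v x i)
       (l + 1 / (12 * real n)) (u + 1 / (4 * real n)) (2 * real n)"
proof -
  obtain P0 Q0 where P0: "pd_inverse n (\<lambda>x i. of_real u * x i - A x i) P0"
    and Q0: "pd_inverse n (\<lambda>x i. A x i - of_real l * x i) Q0"
    and tr0: "optrace n P0 + optrace n Q0 \<le> 2 * real n"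
    using bar by (auto simp: barriers_def)
  define du where "du = 1 / (4 * real n)"
  define dl where "dl = 1 / (12 * real n)"
  have tr0': "0 \<le> optrace n P0" "0 \<le> optrace n Q0"
    using P0 Q0 by (auto intro: optrace_nonneg posdef_inverse)
  define BP where "BP = (\<lambda>x i. (of_real u * x i - A x i) + of_real du * x i)"
  define BQ where "BQ = (\<lambda>x i. (A x i - of_real l * x i) - of_real dl * x i)"
  define normP where "normP = (\<lambda>P. \<Sum>i<n. nsq n (P (unitv i)))"
  obtain P where P: "pd_inverse n BP P" and trP: "optrace n P \<le> optrace n P0 - du * normP P"
    using pd_inverse_shift_up[OF P0, of du] n unfolding BP_def du_def normP_def by auto
  \<comment> \<open>The budget bounds the old trace by \<open>2 n\<close>, so the product is at most
    \<open>1/6\<close>, within the range in which the lower barrier may move.\<close>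
  have "dl * optrace n Q0 \<le> dl * (2 * real n)"
    using tr0 tr0' by (intro mult_left_mono) (auto simp: dl_def)
  also have "\<dots> \<le> 1 / 2" using n by (simp add: dl_def)
  finally obtain Q where Q: "pd_inverse n BQ Q" and trQ: "optrace n Q \<le> optrace n Q0 + dl * normP Q"
      "optrace n Q \<le> 2 * optrace n Q0"
    using pd_inverse_shift_down[OF Q0, of dl] unfolding BQ_def dl_def normP_def by auto
  note sP = selfadj_inverse[OF P] and sQ = selfadj_inverse[OF Q]
  note pP = posdef_inverse[OF P] and pQ = posdef_inverse[OF Q]
  define T where "T = optrace n P + optrace n Q"
  have T: "0 < T" using optrace_pos[OF pP n] optrace_pos[OF pQ n] by (simp add: T_def)
  have "normP P \<ge> 0" by (simp add: normP_def sum_nonneg nsq_nonneg)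
  then have "optrace n P \<le> optrace n P0"
    using trP by (smt (verit) du_def divide_nonneg_nonneg mult_nonneg_nonneg of_nat_0_le_iff)
  with trQ(2) tr0 tr0' have T4: "T \<le> 4 * real n" by (simp add: T_def)
  \<comment> \<open>\<open>\<kappa>\<close> is the ratio of the means of the potential change and of
    \<open>a + b\<close>, so \<open>F\<close> below has mean 0.\<close>
  define \<kappa> where "\<kappa> = (2 * normP P - 2 / 3 * normP Q) / T"
  define a where "a = (\<lambda>x. Re (ip n (P (v x)) (v x)))"
  define b where "b = (\<lambda>x. Re (ip n (Q (v x)) (v x)))"
  define F where "F = (\<lambda>x. 2 * nsq n (P (v x)) - 2 / 3 * nsq n (Q (v x)) - \<kappa> * (a x + b x))"
  have "has_bochner_integral M F (2 * normP P - 2 / 3 * normP Q - \<kappa> * T)"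
    unfolding F_def normP_def a_def b_def T_def
    by (intro has_bochner_integral_diff has_bochner_integral_add has_bochner_integral_mult_right
        isotropic_nsq isotropic_quadratic v sP sQ)
  then have "has_bochner_integral M F 0" using T by (simp add: \<kappa>_def)
  moreover have "F x = 0" if "v x = (\<lambda>_. 0)" for x
    using that by (simp add: F_def a_def b_def selfadj_zero[OF sP] selfadj_zero[OF sQ] nsq_def)
  ultimately obtain x where x: "x \<in> space M" "Z x" "v x \<noteq> (\<lambda>_. 0)" "F x \<le> 0"
    using isotropic_exists_nonpos[OF v n _ _ Z] by blast
  have vx: "v x \<in> vecs n" using v by (simp add: isotropic_def)
  have ab: "0 < a x" "0 < b x" using pP pQ vx x(3) by (auto simp: a_def b_def posdef_def)
  \<comment> \<open>This makes \<open>t * (a x + b x) = T / (8 * real n)\<close> independent of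
    \<open>x\<close>: at most \<open>1/2\<close> because \<open>T \<le> 4 n\<close>, and after
    multiplication by \<open>\<kappa>\<close> equal to \<open>du * normP P - dl * normP Q\<close>,
    since \<open>2/8 = 1/4\<close> and \<open>(2/3)/8 = 1/12\<close>.\<close>
  define t where "t = T / (8 * real n * (a x + b x))"
  have t0: "0 < t" using T ab n by (simp add: t_def)
  have tab: "t * (a x + b x) = T / (8 * real n)" using ab n by (simp add: t_def)
  moreover have "T / (8 * real n) \<le> 1 / 2" using T4 n by (simp add: field_simps)
  ultimately have "t * a x + t * b x \<le> 1 / 2" by (simp add: distrib_left)
  moreover have tpos: "0 < t * a x" "0 < t * b x" using t0 ab by simp_all
  ultimately have ta: "t * a x \<le> 1 / 2" and tb: "t * b x \<le> 1 / 2" by linarith+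
  \<comment> \<open>Adding the rank-one term to \<open>A\<close> subtracts it from the upper
    operator, hence the coefficient \<open>-t\<close>; the lower operator gains it.\<close>
  obtain P' where P': "pd_inverse n (\<lambda>y i. BP y i + of_real (-t) * ip n y (v x) * v x i) P'"
    and trP': "optrace n P' = optrace n P - (-t) / (1 + (-t) * a x) * nsq n (P (v x))"
    using Sherman_Morrison[OF P vx, of "-t"] ta unfolding a_def by auto
  obtain Q' where Q': "pd_inverse n (\<lambda>y i. BQ y i + of_real t * ip n y (v x) * v x i) Q'"
    and trQ': "optrace n Q' = optrace n Q - t / (1 + t * b x) * nsq n (Q (v x))"
    using Sherman_Morrison[OF Q vx, of t] tpos unfolding b_def by auto
  have "t / (1 - t * a x) \<le> 2 * t"
    using t0 ta by (simp add: field_simps)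
  then have "t / (1 - t * a x) * nsq n (P (v x)) \<le> 2 * t * nsq n (P (v x))"
    by (intro mult_right_mono nsq_nonneg)
  then have trP'': "optrace n P' \<le> optrace n P + 2 * t * nsq n (P (v x))"
    using trP' by simp
  have "2 / 3 * t \<le> t / (1 + t * b x)"
    using t0 tb tpos by (simp add: field_simps)
  then have "2 / 3 * t * nsq n (Q (v x)) \<le> t / (1 + t * b x) * nsq n (Q (v x))"
    by (intro mult_right_mono nsq_nonneg)
  then have trQ'': "optrace n Q' \<le> optrace n Q - 2 / 3 * t * nsq n (Q (v x))"
    using trQ' by simp
  have "t * F x \<le> 0" using x(4) t0 by (simp add: mult_nonneg_nonpos)
  then have "2 * t * nsq n (P (v x)) - 2 / 3 * t * nsq n (Q (v x)) \<le> \<kappa> * (t * (a x + b x))"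
    by (simp add: F_def algebra_simps)
  also have "\<dots> = du * normP P - dl * normP Q"
    unfolding tab \<kappa>_def du_def dl_def using T n by (simp add: field_simps)
  \<comment> \<open>The bound on the rank-one change equals the net decrease guaranteed by the two
    shifts, so the budget is restored.\<close>
  finally have "optrace n P' + optrace n Q' \<le> 2 * real n"
    using trP'' trQ'' trP trQ(1) tr0 by linarith
  moreover have "(\<lambda>y i. BP y i + of_real (-t) * ip n y (v x) * v x i)
      = (\<lambda>y i. of_real (u + du) * y i - (A y i + of_real t * ip n y (v x) * v x i))"
    by (simp add: BP_def fun_eq_iff algebra_simps)
  moreover have "(\<lambda>y i. BQ y i + of_real t * ip n y (v x) * v x i)
      = (\<lambda>y i. (A y i + of_real t * ip n y (v x) * v x i) - of_real (l + dl) * y i)"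
    by (simp add: BQ_def fun_eq_iff algebra_simps)
  ultimately have "barriers n (\<lambda>y i. A y i + of_real t * ip n y (v x) * v x i)
       (l + dl) (u + du) (2 * real n)"
    unfolding barriers_def using P' Q' by auto
  then show ?thesis
    unfolding du_def dl_def by (rule that[OF x(1,2) less_imp_le[OF t0]])
qed

text \<open>Both barrier operators are the identity, each contributing trace \<open>n\<close>; this
  fixes the budget \<open>2 n\<close>.\<close>

lemma barriers_init: "barriers n (\<lambda>_ _. 0) (-1) 1 (2 * real n)"
proof -
  have "pd_inverse n (\<lambda>x i. x i) (\<lambda>x i. x i)"
    by (auto simp: pd_inverse_def posdef_def selfadj_def ip_self nsq_pos)
  moreover have "optrace n (\<lambda>x i. x i) = real n"
    by (simp add: optrace_def unitv_def)
  ultimately show ?thesis unfolding barriers_def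
    by (intro exI[of _ "\<lambda>x i. x i"]) simp
qed

lemma barriers_iterate:
  assumes v: "isotropic M n v" and n: "0 < n" and Z: "AE x in M. Z x"
  shows "\<exists>\<xi> w. (\<forall>j<k. \<xi> j \<in> space M \<and> Z (\<xi> j) \<and> 0 \<le> w j) \<and>
    barriers n (\<lambda>y i. \<Sum>j<k. of_real (w j) * ip n y (v (\<xi> j)) * v (\<xi> j) i)
      (real k / (12 * real n) - 1) (real k / (4 * real n) + 1) (2 * real n)"
proof (induction k)
  case 0
  then show ?case using barriers_init by simp
next
  case (Suc k)
  then obtain \<xi> w where \<xi>: "\<forall>j<k. \<xi> j \<in> space M \<and> Z (\<xi> j) \<and> 0 \<le> w j"
    and bar: "barriers n (\<lambda>y i. \<Sum>j<k. of_real (w j) * ip n y (v (\<xi> j)) * v (\<xi> j) i)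
      (real k / (12 * real n) - 1) (real k / (4 * real n) + 1) (2 * real n)"
    by blast
  obtain x t where x: "x \<in> space M" "Z x" "0 \<le> t"
    and bar': "barriers n (\<lambda>y i. (\<Sum>j<k. of_real (w j) * ip n y (v (\<xi> j)) * v (\<xi> j) i)
         + of_real t * ip n y (v x) * v x i)
       (real k / (12 * real n) - 1 + 1 / (12 * real n)) (real k / (4 * real n) + 1 + 1 / (4 * real n))
       (2 * real n)"
    by (rule barriers_step[OF v n Z bar])
  have "real k / (12 * real n) - 1 + 1 / (12 * real n) = real (Suc k) / (12 * real n) - 1"
    "real k / (4 * real n) + 1 + 1 / (4 * real n) = real (Suc k) / (4 * real n) + 1"
    by (simp_all add: add_divide_distrib)
  with bar' have "barriers n (\<lambda>y i. \<Sum>j<Suc k. of_real ((w(k := t)) j) * ip n y (v ((\<xi>(k := x)) j))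
         * v ((\<xi>(k := x)) j) i)
      (real (Suc k) / (12 * real n) - 1) (real (Suc k) / (4 * real n) + 1) (2 * real n)"
    by simp
  then show ?case
    using \<xi> x by (intro exI[of _ "\<xi>(k := x)"] exI[of _ "w(k := t)"]) (auto simp: less_Suc_eq)
qed

lemma barriers_bounds:
  assumes "barriers n A l u \<Phi>" "y \<in> vecs n"
  shows "l * nsq n y \<le> Re (ip n (A y) y)" "Re (ip n (A y) y) \<le> u * nsq n y"
proof -
  obtain P Q where "pd_inverse n (\<lambda>x i. of_real u * x i - A x i) P"
    "pd_inverse n (\<lambda>x i. A x i - of_real l * x i) Q"
    using assms(1) by (auto simp: barriers_def)
  from this[THEN pd_inverse_posdef, THEN posdef_nonneg, OF assms(2)]
  show "l * nsq n y \<le> Re (ip n (A y) y)" "Re (ip n (A y) y) \<le> u * nsq n y"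
    by (simp_all add: ip_linear ip_self)
qed

lemma ip_sum_left: "ip n (\<lambda>i. \<Sum>j\<in>J. f j i) y = (\<Sum>j\<in>J. ip n (f j) y)"
  unfolding ip_def sum_distrib_right by (rule sum.swap)

text \<open>The quadratic form of the operator built by the greedy steps is the weighted sum of
  squares, so its barriers become the sampling constants. \<open>Z\<close> forces the selected
  points off a prescribed null set.\<close>

proposition isotropic_sampling:
  assumes v: "isotropic M n v" and Z: "AE x in M. Z x"
  obtains \<xi> w where "\<And>j. j < 24 * n \<Longrightarrow> \<xi> j \<in> space M \<and> Z (\<xi> j) \<and> 0 \<le> w j"
    "\<And>y. y \<in> vecs n \<Longrightarrow> nsq n y \<le> (\<Sum>j<24 * n. w j * (cmod (ip n y (v (\<xi> j))))\<^sup>2)"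
    "\<And>y. y \<in> vecs n \<Longrightarrow> (\<Sum>j<24 * n. w j * (cmod (ip n y (v (\<xi> j))))\<^sup>2) \<le> 7 * nsq n y"
\<comment> \<open>The barrier speeds divide by \<open>n\<close>; in dimension 0 there are no points
  and both sides are 0.\<close>
proof (cases "n = 0")
  case True
  then show ?thesis using that by (simp add: nsq_def)
next
  case False
  then obtain \<xi> w where \<xi>: "\<forall>j<24 * n. \<xi> j \<in> space M \<and> Z (\<xi> j) \<and> 0 \<le> w j"
    and bar: "barriers n (\<lambda>y i. \<Sum>j<24 * n. of_real (w j) * ip n y (v (\<xi> j)) * v (\<xi> j) i)
      (real (24 * n) / (12 * real n) - 1) (real (24 * n) / (4 * real n) + 1) (2 * real n)"
    using barriers_iterate[OF v _ Z, of "24 * n"] by blast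
  \<comment> \<open>The barriers end at \<open>-1 + 24/12\<close> and
    \<open>1 + 24/4\<close>.\<close>
  have lu: "real (24 * n) / (12 * real n) - 1 = 1" "real (24 * n) / (4 * real n) + 1 = 7"
    using False by simp_all
  have eq: "Re (ip n (\<lambda>i. \<Sum>j<24 * n. of_real (w j) * ip n y (v (\<xi> j)) * v (\<xi> j) i) y)
      = (\<Sum>j<24 * n. w j * (cmod (ip n y (v (\<xi> j))))\<^sup>2)" for y
    by (simp add: ip_sum_left ip_scale_left mult.assoc ip_mult_cnj del: of_real_power)
  show ?thesis
    using that[of \<xi> w] \<xi> barriers_bounds[OF bar, unfolded lu eq] by simp
qed

section \<open>Orthonormal systems modulo null functions\<close>

text \<open>Membership in \<open>L2_fun\<close> makes the products integrable, so the zero integrals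
  express orthogonality and not the default value of a non-integrable function.\<close>

definition orthonormal_upto :: "'a measure \<Rightarrow> nat \<Rightarrow> (nat \<Rightarrow> 'a \<Rightarrow> complex) \<Rightarrow> bool" where
  "orthonormal_upto M k e \<longleftrightarrow> (\<forall>i<k. e i \<in> L2_fun M) \<and>
     (\<forall>i<k. \<forall>j<k. (\<integral>x. e i x * cnj (e j x) \<partial>M) = (if i = j then 1 else 0))"

lemma L2_fun_integrable_mult:
  assumes "f \<in> L2_fun M" "g \<in> L2_fun M"
  shows "integrable M (\<lambda>x. f x * cnj (g x))"
proof (rule Bochner_Integration.integrable_bound)
  show "integrable M (\<lambda>x. (cmod (f x))\<^sup>2 + (cmod (g x))\<^sup>2)"
    using assms by (simp add: L2_fun_def)
  have [measurable]: "f \<in> borel_measurable M" "g \<in> borel_measurable M"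
    using assms by (auto simp: L2_fun_def)
  have cnj: "cnj \<in> borel_measurable borel"
    by (intro borel_measurable_continuous_onI continuous_intros)
  show "(\<lambda>x. f x * cnj (g x)) \<in> borel_measurable M"
    by (intro borel_measurable_times measurable_compose[OF _ cnj]) measurable
  have "cmod a * cmod b \<le> (cmod a)\<^sup>2 + (cmod b)\<^sup>2" for a b
    using sum_squares_bound[of "cmod a" "cmod b"] mult_nonneg_nonneg[OF norm_ge_zero norm_ge_zero, of a b]
    by linarith
  then show "AE x in M. norm (f x * cnj (g x)) \<le> norm ((cmod (f x))\<^sup>2 + (cmod (g x))\<^sup>2)"
    by (simp add: norm_mult)
qed

lemma L2_fun_add:
  assumes "f \<in> L2_fun M" "g \<in> L2_fun M"
  shows "(\<lambda>x. f x + c * g x) \<in> L2_fun M"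
proof -
  have [measurable]: "f \<in> borel_measurable M" "g \<in> borel_measurable M"
    using assms by (auto simp: L2_fun_def)
  have "integrable M (\<lambda>x. (cmod (f x + c * g x))\<^sup>2)"
  proof (rule Bochner_Integration.integrable_bound)
    show "integrable M (\<lambda>x. 2 * (cmod (f x))\<^sup>2 + 2 * (cmod c)\<^sup>2 * (cmod (g x))\<^sup>2)"
      using assms by (simp add: L2_fun_def)
    have le: "(cmod (a + b))\<^sup>2 \<le> 2 * (cmod a)\<^sup>2 + 2 * (cmod b)\<^sup>2" for a b
    proof -
      have "(cmod (a + b))\<^sup>2 \<le> (cmod a + cmod b)\<^sup>2"
        by (intro power_mono norm_triangle_ineq) auto
      also have "\<dots> \<le> 2 * (cmod a)\<^sup>2 + 2 * (cmod b)\<^sup>2"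
        using sum_squares_bound[of "cmod a" "cmod b"] by (simp add: power2_sum)
      finally show ?thesis .
    qed
    have "(cmod (f x + c * g x))\<^sup>2 \<le> 2 * (cmod (f x))\<^sup>2 + 2 * (cmod c)\<^sup>2 * (cmod (g x))\<^sup>2" for x
      using le[of "f x" "c * g x"] by (simp add: norm_mult power_mult_distrib)
    then show "AE x in M. norm ((cmod (f x + c * g x))\<^sup>2)
        \<le> norm (2 * (cmod (f x))\<^sup>2 + 2 * (cmod c)\<^sup>2 * (cmod (g x))\<^sup>2)"
      by (intro AE_I2) simp
  qed measurable
  then show ?thesis using assms by (auto simp: L2_fun_def)
qed

lemma L2_fun_sum:
  fixes k :: nat
  assumes "f \<in> L2_fun M" "\<And>i. i < k \<Longrightarrow> e i \<in> L2_fun M"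
  shows "(\<lambda>x. f x + (\<Sum>i<k. c i * e i x)) \<in> L2_fun M"
  using assms(2)
proof (induction k)
  case (Suc k)
  then have "(\<lambda>x. (f x + (\<Sum>i<k. c i * e i x)) + c k * e k x) \<in> L2_fun M"
    by (intro L2_fun_add) auto
  then show ?case by (simp add: add.assoc)
qed (use assms(1) in simp)

lemma integral_cmod_square:
  fixes f :: "'a \<Rightarrow> complex"
  shows "(\<integral>x. f x * cnj (f x) \<partial>M) = of_real (\<integral>x. (cmod (f x))\<^sup>2 \<partial>M)"
  unfolding complex_norm_square[symmetric] by (rule integral_complex_of_real)

text \<open>Linearly independent functions may be dependent almost everywhere, so \<open>k\<close> may be smaller than
  \<open>card U\<close>.\<close>

lemma Gram_Schmidt_AE:
  assumes "finite U" "U \<subseteq> L2_fun M"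
  shows "\<exists>k e. k \<le> card U \<and> orthonormal_upto M k e \<and>
    (\<forall>u\<in>U. \<exists>c. AE x in M. u x = (\<Sum>i<k. c i * e i x))"
  using assms
proof (induction U rule: finite_induct)
  case empty
  show ?case by (intro exI[of _ 0]) (simp add: orthonormal_upto_def)
next
  case (insert u U)
  then obtain k e where k: "k \<le> card U" and on: "orthonormal_upto M k e"
    and rep: "\<forall>u\<in>U. \<exists>c. AE x in M. u x = (\<Sum>i<k. c i * e i x)" by auto
  have u: "u \<in> L2_fun M" using insert by simp
  have e: "e i \<in> L2_fun M" if "i < k" for i using on that by (simp add: orthonormal_upto_def)
  \<comment> \<open>These are the Fourier coefficients of \<open>u\<close>; \<open>h\<close> is the
    residual after projection onto the system found so far.\<close>
  define c where "c = (\<lambda>i. \<integral>x. u x * cnj (e i x) \<partial>M)"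
  define h where "h = (\<lambda>x. u x + (\<Sum>i<k. (- c i) * e i x))"
  have h: "h \<in> L2_fun M" unfolding h_def by (rule L2_fun_sum[OF u e])
  have u_eq: "u x = (\<Sum>i<k. c i * e i x) + h x" for x by (simp add: h_def sum_negf)
  have h_orth: "(\<integral>x. h x * cnj (e j x) \<partial>M) = 0" if j: "j < k" for j
  proof -
    \<comment> \<open>The coefficients are written out as integrals to match the goal after
      \<open>c_def\<close> is unfolded.\<close>
    have int: "integrable M (\<lambda>x. \<Sum>i<k. (- (\<integral>x. u x * cnj (e i x) \<partial>M)) * (e i x * cnj (e j x)))"
      using j e by (intro Bochner_Integration.integrable_sum integrable_mult_right L2_fun_integrable_mult) auto
    have "(\<integral>x. h x * cnj (e j x) \<partial>M)
        = (\<integral>x. u x * cnj (e j x) + (\<Sum>i<k. (- c i) * (e i x * cnj (e j x))) \<partial>M)"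
      by (simp add: h_def distrib_right sum_distrib_right mult.assoc)
    also have "\<dots> = c j + (\<Sum>i<k. (- c i) * (\<integral>x. e i x * cnj (e j x) \<partial>M))"
      unfolding c_def Bochner_Integration.integral_add[OF L2_fun_integrable_mult[OF u e[OF j]] int]
      by (subst Bochner_Integration.integral_sum)
        (use j e in \<open>auto intro!: integrable_mult_right L2_fun_integrable_mult\<close>)
    also have "(\<Sum>i<k. (- c i) * (\<integral>x. e i x * cnj (e j x) \<partial>M)) = (\<Sum>i<k. if i = j then - c i else 0)"
      using on j by (intro sum.cong) (auto simp: orthonormal_upto_def)
    finally show ?thesis using j by simp
  qed
  define s where "s = (\<integral>x. (cmod (h x))\<^sup>2 \<partial>M)"
  have s: "0 \<le> s" by (simp add: s_def)
  show ?case
  \<comment> \<open>A residual of norm 0 vanishes almost everywhere, so the old system already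
    represents \<open>u\<close> off a null set. Otherwise the normalised residual is
    appended.\<close>
  proof (cases "s = 0")
    case True
    have "AE x in M. (cmod (h x))\<^sup>2 = 0"
      using True h unfolding s_def
      by (subst integral_nonneg_eq_0_iff_AE[symmetric]) (auto simp: L2_fun_def)
    then have "AE x in M. u x = (\<Sum>i<k. c i * e i x)"
      by eventually_elim (simp add: u_eq)
    then have "\<forall>u\<in>insert u U. \<exists>c. AE x in M. u x = (\<Sum>i<k. c i * e i x)"
      using rep by auto
    then show ?thesis using k on insert.hyps by (intro exI[of _ k] exI[of _ e]) simp
  next
    case False
    define r where "r = sqrt s"
    have r: "0 < r" "r * r = s" using s False by (simp_all add: r_def)
    define g where "g = (\<lambda>x. h x / of_real r)"
    have g: "g \<in> L2_fun M"
      using L2_fun_add[of "\<lambda>_. 0" M h "1 / of_real r"] h by (simp add: g_def L2_fun_def)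
    have gg: "(\<integral>x. g x * cnj (g x) \<partial>M) = 1"
    proof -
      have "(\<integral>x. g x * cnj (g x) \<partial>M) = (\<integral>x. h x * cnj (h x) \<partial>M) / of_real (r * r)"
        by (simp add: g_def flip: integral_divide_zero)
      then show ?thesis using r False by (simp add: integral_cmod_square flip: s_def)
    qed
    have ge: "(\<integral>x. g x * cnj (e j x) \<partial>M) = 0" if "j < k" for j
      using h_orth[OF that] by (simp add: g_def)
    have eg: "(\<integral>x. e j x * cnj (g x) \<partial>M) = 0" if "j < k" for j
    proof -
      have "(\<integral>x. e j x * cnj (g x) \<partial>M) = (\<integral>x. cnj (g x * cnj (e j x)) \<partial>M)"
        by (simp add: mult.commute)
      also have "\<dots> = 0" using ge[OF that] by (simp only: Bochner_Integration.integral_cnj complex_cnj_zero)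
      finally show ?thesis .
    qed
    have "orthonormal_upto M (Suc k) (e(k := g))"
      using on g gg ge eg by (auto simp: orthonormal_upto_def less_Suc_eq)
    moreover have "\<exists>c. AE x in M. u' x = (\<Sum>i<Suc k. c i * (e(k := g)) i x)"
      if u': "u' \<in> insert u U" for u'
    proof (cases "u' = u")
      case True
      \<comment> \<open>The new coefficient is the norm of the residual, because
        \<open>h = r g\<close>.\<close>
      have "u x = (\<Sum>i<Suc k. (c(k := of_real r)) i * (e(k := g)) i x)" for x
        using r by (simp add: u_eq g_def)
      then show ?thesis unfolding True by (intro exI[of _ "c(k := of_real r)"]) simp
    next
      case False
      then obtain d where "AE x in M. u' x = (\<Sum>i<k. d i * e i x)"
        using u' rep by auto
      then show ?thesis by (intro exI[of _ "d(k := 0)"]) simp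
    qed
    moreover have "Suc k \<le> card (insert u U)" using k insert.hyps by simp
    ultimately show ?thesis by blast
  qed
qed

section \<open>From coordinate vectors to functions\<close>

text \<open>The points at which the representation of \<open>f\<close> holds are controlled by the
  generators alone. One exceptional null set therefore serves all functions of the span at once,
  however many there are.\<close>

lemma span_eq_sum:
  assumes "f \<in> cfun.span U"
  shows "\<exists>c. \<forall>x. (\<forall>u\<in>U. u x = (\<Sum>i<k. C u i * e i x)) \<longrightarrow> f x = (\<Sum>i<k. c i * (e i x :: complex))"
  using assms
proof (induction rule: cfun.span_induct_alt)
  case base
  show ?case by (intro exI[of _ "\<lambda>_. 0"]) simp
next
  case (step a u f)
  then obtain c where c: "\<forall>x. (\<forall>u\<in>U. u x = (\<Sum>i<k. C u i * e i x)) \<longrightarrow> f x = (\<Sum>i<k. c i * e i x)"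
    by blast
  have "(fun_scale a u + f) x = (\<Sum>i<k. (a * C u i + c i) * e i x)"
    if x: "\<forall>u\<in>U. u x = (\<Sum>i<k. C u i * e i x)" for x
  proof -
    have ux: "u x = (\<Sum>i<k. C u i * e i x)" using x step(1) by blast
    have fx: "f x = (\<Sum>i<k. c i * e i x)" using x c by blast
    show ?thesis
      by (simp add: fun_scale_def ux fx sum.distrib sum_distrib_left distrib_right mult.assoc)
  qed
  then show ?case by (intro exI[of _ "\<lambda>i. a * C u i + c i"]) simp
qed

text \<open>Wherever \<open>Z\<close> holds, \<open>f x\<close> is the inner product of a
  coefficient vector with \<open>v x\<close>, and isotropy identifies the norm of that vector with
  the norm of \<open>f\<close>. Since functions are evaluated pointwise, the sample points
  themselves must satisfy \<open>Z\<close>.\<close>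

lemma L2_span_sampling:
  assumes U: "finite U" and span_L2: "cfun.span U \<subseteq> L2_fun M"
  obtains m \<xi> w where "m \<le> 24 * card U"
    "\<And>j. j < m \<Longrightarrow> \<xi> j \<in> space M \<and> 0 \<le> w j"
    "\<And>f. f \<in> cfun.span U \<Longrightarrow> (L2_norm M f)\<^sup>2 \<le> (\<Sum>j<m. w j * (cmod (f (\<xi> j)))\<^sup>2)"
    "\<And>f. f \<in> cfun.span U \<Longrightarrow> (\<Sum>j<m. w j * (cmod (f (\<xi> j)))\<^sup>2) \<le> 7 * (L2_norm M f)\<^sup>2"
proof -
  obtain k e where k: "k \<le> card U" and on: "orthonormal_upto M k e"
    and rep: "\<forall>u\<in>U. \<exists>c. AE x in M. u x = (\<Sum>i<k. c i * e i x)"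
    using Gram_Schmidt_AE[OF U] cfun.span_superset[of U] span_L2 by blast
  obtain C where C: "\<And>u. u \<in> U \<Longrightarrow> AE x in M. u x = (\<Sum>i<k. C u i * e i x)"
    using rep by metis
  define Z where "Z = (\<lambda>x. \<forall>u\<in>U. u x = (\<Sum>i<k. C u i * e i x))"
  \<comment> \<open>Finiteness of \<open>U\<close> keeps the union of the exceptional sets
    null.\<close>
  have Z: "AE x in M. Z x" unfolding Z_def by (rule AE_finite_allI[OF U C])
  define v where "v = (\<lambda>x i. if i < k then cnj (e i x) else 0)"
  have v: "isotropic M k v"
    unfolding isotropic_def
  proof (intro conjI allI impI)
    show "v x \<in> vecs k" for x by (simp add: v_def vecs_def)
    fix i j assume ij: "i < k" "j < k"
    then have "has_bochner_integral M (\<lambda>x. e j x * cnj (e i x)) (if j = i then 1 else 0)"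
      using on by (auto simp: has_bochner_integral_iff orthonormal_upto_def intro!: L2_fun_integrable_mult)
    then show "has_bochner_integral M (\<lambda>x. v x i * cnj (v x j)) (if i = j then 1 else 0)"
      using ij by (simp add: v_def mult.commute eq_commute)
  qed
  obtain \<xi> w where \<xi>: "\<And>j. j < 24 * k \<Longrightarrow> \<xi> j \<in> space M \<and> Z (\<xi> j) \<and> 0 \<le> w j"
    and lower: "\<And>y. y \<in> vecs k \<Longrightarrow> nsq k y \<le> (\<Sum>j<24 * k. w j * (cmod (ip k y (v (\<xi> j))))\<^sup>2)"
    and upper: "\<And>y. y \<in> vecs k \<Longrightarrow> (\<Sum>j<24 * k. w j * (cmod (ip k y (v (\<xi> j))))\<^sup>2) \<le> 7 * nsq k y"
    using isotropic_sampling[OF v Z] by blast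
  have "\<exists>y\<in>vecs k. (L2_norm M f)\<^sup>2 = nsq k y \<and> (\<forall>j<24 * k. f (\<xi> j) = ip k y (v (\<xi> j)))"
    if f: "f \<in> cfun.span U" for f
  proof -
    obtain c where c: "\<And>x. Z x \<Longrightarrow> f x = (\<Sum>i<k. c i * e i x)"
      using span_eq_sum[OF f] unfolding Z_def by blast
    define y where "y = (\<lambda>i. if i < k then c i else 0)"
    have fy: "f x = ip k y (v x)" if "Z x" for x
      using c[OF that] by (simp add: y_def v_def ip_def)
    \<comment> \<open>Isotropy with both vectors equal to \<open>y\<close> is Parseval's identity
      for the represented function.\<close>
    have "has_bochner_integral M (\<lambda>x. Re (ip k (v x) y * ip k y (v x))) (Re (ip k y y))"
      by (intro has_bochner_integral_bounded_linear[OF bounded_linear_Re] isotropic_ip v)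
    then have "has_bochner_integral M (\<lambda>x. (cmod (ip k y (v x)))\<^sup>2) (nsq k y)"
      by (simp only: ip_mult_cnj ip_self Re_complex_of_real norm_ip_commute[of k y])
    then have int: "integrable M (\<lambda>x. (cmod (ip k y (v x)))\<^sup>2)"
      and "(\<integral>x. (cmod (ip k y (v x)))\<^sup>2 \<partial>M) = nsq k y"
      by (simp_all add: has_bochner_integral_iff)
    moreover have "(\<integral>x. (cmod (f x))\<^sup>2 \<partial>M) = (\<integral>x. (cmod (ip k y (v x)))\<^sup>2 \<partial>M)"
    proof (rule integral_cong_AE)
      show "(\<lambda>x. (cmod (f x))\<^sup>2) \<in> borel_measurable M"
        using f span_L2 by (auto simp: L2_fun_def)
      show "AE x in M. (cmod (f x))\<^sup>2 = (cmod (ip k y (v x)))\<^sup>2"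
        using Z by eventually_elim (simp add: fy)
    qed (use int in simp)
    ultimately have "(L2_norm M f)\<^sup>2 = nsq k y"
      by (simp add: L2_norm_def nsq_nonneg)
    moreover have "y \<in> vecs k" by (simp add: y_def vecs_def)
    ultimately show ?thesis using fy \<xi> by blast
  qed
  note * = this
  show ?thesis
  proof (rule that[of "24 * k" \<xi> w])
    fix f assume "f \<in> cfun.span U"
    from *[OF this] obtain y where y: "y \<in> vecs k" "(L2_norm M f)\<^sup>2 = nsq k y"
      and fy: "\<forall>j<24 * k. f (\<xi> j) = ip k y (v (\<xi> j))" by blast
    have eq: "(\<Sum>j<24 * k. w j * (cmod (f (\<xi> j)))\<^sup>2) = (\<Sum>j<24 * k. w j * (cmod (ip k y (v (\<xi> j))))\<^sup>2)"
      using fy by (intro sum.cong) auto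
    show "(L2_norm M f)\<^sup>2 \<le> (\<Sum>j<24 * k. w j * (cmod (f (\<xi> j)))\<^sup>2)"
      unfolding eq y(2) by (rule lower[OF y(1)])
    show "(\<Sum>j<24 * k. w j * (cmod (f (\<xi> j)))\<^sup>2) \<le> 7 * (L2_norm M f)\<^sup>2"
      unfolding eq y(2) by (rule upper[OF y(1)])
  qed (use k \<xi> in auto)
qed

section \<open>Conclusion with explicit absolute constants\<close>

theorem theorem1p2:
  "\<exists>C1 c0 C0 :: real. C1 > 0 \<and> c0 > 0 \<and> C0 > 0 \<and>
    (\<forall>(d::nat) (\<Omega> :: (nat \<Rightarrow> real) set) (\<mu> :: (nat \<Rightarrow> real) measure)
        (N::nat) (X :: ((nat \<Rightarrow> real) \<Rightarrow> complex) set).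
      \<Omega> \<subseteq> Rd d \<longrightarrow> \<Omega> \<noteq> {} \<longrightarrow> prob_space \<mu> \<longrightarrow> space \<mu> = \<Omega> \<longrightarrow> L2_subspace_dim \<mu> N X \<longrightarrow>
      (\<exists>(m::nat) (\<xi> :: nat \<Rightarrow> nat \<Rightarrow> real) (w :: nat \<Rightarrow> real).
        real m \<le> C1 * real N \<and>
        (\<forall>j\<in>{1..m}. \<xi> j \<in> \<Omega> \<and> w j \<ge> 0) \<and>
        (\<forall>f\<in>X. c0 * (L2_norm \<mu> f)\<^sup>2 \<le> (\<Sum>j=1..m. w j * (cmod (f (\<xi> j)))\<^sup>2) \<and>
               (\<Sum>j=1..m. w j * (cmod (f (\<xi> j)))\<^sup>2) \<le> C0 * (L2_norm \<mu> f)\<^sup>2)))"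
\<comment> \<open>The 24 counts greedy steps per dimension; 1 and 7 are the final barrier
  positions.\<close>
proof (rule exI[of _ 24], rule exI[of _ 1], rule exI[of _ 7], intro conjI allI impI)
  fix d N :: nat and \<Omega> :: "(nat \<Rightarrow> real) set" and \<mu> :: "(nat \<Rightarrow> real) measure"
    and X :: "((nat \<Rightarrow> real) \<Rightarrow> complex) set"
  assume sp: "space \<mu> = \<Omega>" and "L2_subspace_dim \<mu> N X"
  then obtain U where U: "finite U" "card U = N" "X = cfun.span U" "X \<subseteq> L2_fun \<mu>"
    by (auto simp: L2_subspace_dim_def)
  then obtain m \<xi> w where m: "m \<le> 24 * card U"
    and \<xi>: "\<And>j. j < m \<Longrightarrow> \<xi> j \<in> space \<mu> \<and> 0 \<le> w j"
    and lower: "\<And>f. f \<in> cfun.span U \<Longrightarrow> (L2_norm \<mu> f)\<^sup>2 \<le> (\<Sum>j<m. w j * (cmod (f (\<xi> j)))\<^sup>2)"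
    and upper: "\<And>f. f \<in> cfun.span U \<Longrightarrow> (\<Sum>j<m. w j * (cmod (f (\<xi> j)))\<^sup>2) \<le> 7 * (L2_norm \<mu> f)\<^sup>2"
    using L2_span_sampling[of U \<mu>] by blast
  \<comment> \<open>The sampling lemma indexes points from 0, the theorem from 1; on
    \<open>{1..m}\<close> the natural-number subtraction does not truncate.\<close>
  have eq: "(\<Sum>j=1..m. w (j - 1) * (cmod (f (\<xi> (j - 1))))\<^sup>2) = (\<Sum>j<m. w j * (cmod (f (\<xi> j)))\<^sup>2)"
    for f :: "(nat \<Rightarrow> real) \<Rightarrow> complex"
    by (rule sum.reindex_bij_witness[of _ Suc "\<lambda>j. j - 1"]) auto
  show "\<exists>m \<xi> w. real m \<le> 24 * real N \<and> (\<forall>j\<in>{1..m}. \<xi> j \<in> \<Omega> \<and> w j \<ge> 0) \<and>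
        (\<forall>f\<in>X. 1 * (L2_norm \<mu> f)\<^sup>2 \<le> (\<Sum>j=1..m. w j * (cmod (f (\<xi> j)))\<^sup>2) \<and>
               (\<Sum>j=1..m. w j * (cmod (f (\<xi> j)))\<^sup>2) \<le> 7 * (L2_norm \<mu> f)\<^sup>2)"
  proof (intro exI[of _ m] exI[of _ "\<lambda>j. \<xi> (j - 1)"] exI[of _ "\<lambda>j. w (j - 1)"] conjI ballI)
    show "real m \<le> 24 * real N" using of_nat_mono[OF m, where ?'a = real] U(2) by simp
    show "\<xi> (j - 1) \<in> \<Omega>" "0 \<le> w (j - 1)" if "j \<in> {1..m}" for j
      using \<xi>[of "j - 1"] that sp by auto
  qed (use lower upper U(3) in \<open>simp_all only: eq mult_1\<close>)
qed simp_all

end
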